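(* Let $n\in\mathbb{N}\cup\{\infty\}$, let $(G,+,0)$ be an abelian group, let $\mathbf{c}=(c_i)_{i\in\mathbb{Z}_n}$ be a sequence in $G$ with $c_0=0$ such that $\{c_i\mid i\in\mathbb{Z}_n\}$ generates $G$, and let $(X,\sigma,\tau)=\mathcal{S}(G\times\mathbb{Z}_n,\mathbf{c})$. Let $\theta_1=\theta(m_1,H_1,r_1)$ and $\theta_2=\theta(m_2,H_2,r_2)$ be congruences of $(X,\sigma,\tau)$. Then the quotient solutions $(X,\sigma,\tau)/\theta_1$ and $(X,\sigma,\tau)/\theta_2$ are isomorphic if and only if $m_1=m_2$, $H_1=H_2$ and $r_1\equiv r_2\pmod{H_2}$.
   Context: $\mathbb{N}$ denotes the positive integers. $\mathbb{Z}_n=\mathbb{Z}/n\mathbb{Z}$ for finite $n$, and $\mathbb{Z}_\infty=\mathbb{Z}$; $a\equiv b\pmod\infty$ means $a=b$. A solution (set-theoretic, non-degenerate, involutive solution of the Yang-Baxter equation) is a triple $(X,\sigma,\tau)$ with $X$ a non-empty set and $\sigma,\tau\colon X^2\to X$ such that, writing $\sigma_x=\sigma(x,\cdot)$ and $\tau_y=\tau(\cdot,y)$, the map $r(x,y)=(\sigma_x(y),\tau_y(x))$ is a bijection of $X^2$ satisfying $(\mathrm{id}\times r)(r\times \mathrm{id})(\mathrm{id}\times r)=(r\times \mathrm{id})(\mathrm{id}\times r)(r\times \mathrm{id})$, all $\sigma_x,\tau_y$ are bijections, and $r^2=\mathrm{id}$. An isomorphism $(X,\sigma,\tau)\to(X',\sigma',\tau')$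 is a bijection $\Phi$ with $\Phi\sigma_x=\sigma'_{\Phi(x)}\Phi$ for all $x\in X$. $\mathcal{S}(G\times\mathbb{Z}_n,\mathbf{c})$ denotes the solution $(G\times\mathbb{Z}_n,\sigma,\tau)$ with $\sigma_{(a,i)}((b,j))=(b+c_{i-j-1}-c_{-j-1},j+1)$ and $\tau_{(a,i)}((b,j))=(b-c_{i-j+1}+c_{-j},j-1)$. A congruence of a solution is an equivalence relation $\asymp$ such that $x_1\asymp x_2$ and $y_1\asymp y_2$ imply $\sigma_{x_1}^{\varepsilon}(y_1)\asymp\sigma_{x_2}^{\varepsilon}(y_2)$ for $\varepsilon\in\{-1,1\}$; the quotient set then carries the induced quotient solution. Let $H\le G$ be a subgroup, $m\in\mathbb{N}\cup\{\infty\}$, $r\in G$ be such that: $m$ is finite and divides $n$ if $n$ is finite; $c_i-c_{i+m}\in H$ for all $i\in\mathbb{Z}_n$ if $m$ is finite; $\frac nm\cdot r\in H$ if $n$ and $m$ are finite. Then $\theta(m,H,r)$ denotes the congruence $\asymp$ of $\mathcal{S}(G\times\mathbb{Z}_n,\mathbf{c})$ given by: $(a,i)\asymp(a',i')$ iff $i-i'\equiv0\pmod m$ and $a'-a\equiv\frac{i-i'}{m}\cdot r\pmod H$ (if $m<\infty$), respectively $a'-a\in H$ (if $m=\infty$). (For finite $n$, $i,i'$ are represented by integers; the condition is independent of the representatives. Every congruence of $\mathcal{S}(G\times\mathbb{Z}_n,\mathbf{c})$ is of this form.)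
   Formalization: The condition r_1 ≡ r_2 (mod H_2) is required only when m_1 is finite; for m_1 = m_2 = ∞ the congruence θ(m,H,r) does not depend on r, so the condition as written would be false there. *)

theory Defs
  imports "HOL-Algebra.Generated_Groups" "HOL-Library.Extended_Nat"
begin

section \<open>Solutions of the Yang-Baxter equation\<close>

text \<open>
  Both operations are functions on pairs of elements, written in the order in which the pair is
  written: \<open>lsol S x y\<close> is $\sigma(x,y) = \sigma_x(y)$ and \<open>rsol S x y\<close> is
  $\tau(x,y) = \tau_y(x)$. Thus $\tau_y$ is \<open>\<lambda>x. rsol S x y\<close>.
\<close>

record 'x solution_data = "'x partial_object" +
  lsol :: "'x \<Rightarrow> 'x \<Rightarrow> 'x"
  rsol :: "'x \<Rightarrow> 'x \<Rightarrow> 'x"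

definition yb_map :: "'x solution_data \<Rightarrow> 'x \<times> 'x \<Rightarrow> 'x \<times> 'x" where
  "yb_map S = (\<lambda>(x, y). (lsol S x y, rsol S x y))"

definition yb_left :: "'x solution_data \<Rightarrow> 'x \<times> 'x \<times> 'x \<Rightarrow> 'x \<times> 'x \<times> 'x" where
  "yb_left S = (\<lambda>(x, y, z). (lsol S x y, rsol S x y, z))"

definition yb_right :: "'x solution_data \<Rightarrow> 'x \<times> 'x \<times> 'x \<Rightarrow> 'x \<times> 'x \<times> 'x" where
  "yb_right S = (\<lambda>(x, y, z). (x, lsol S y z, rsol S y z))"

definition is_solution :: "'x solution_data \<Rightarrow> bool" where
  "is_solution S \<longleftrightarrow>
     carrier S \<noteq> {} \<and>
     bij_betw (yb_map S) (carrier S \<times> carrier S) (carrier S \<times> carrier S) \<and>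
     (\<forall>t \<in> carrier S \<times> carrier S \<times> carrier S.
        yb_right S (yb_left S (yb_right S t)) = yb_left S (yb_right S (yb_left S t))) \<and>
     (\<forall>x \<in> carrier S. bij_betw (\<lambda>y. lsol S x y) (carrier S) (carrier S)) \<and>
     (\<forall>y \<in> carrier S. bij_betw (\<lambda>x. rsol S x y) (carrier S) (carrier S)) \<and>
     (\<forall>p \<in> carrier S \<times> carrier S. yb_map S (yb_map S p) = p)"

definition solution_iso :: "'x solution_data \<Rightarrow> 'y solution_data \<Rightarrow> ('x \<Rightarrow> 'y) \<Rightarrow> bool" where
  "solution_iso S S' \<Phi> \<longleftrightarrow>
     bij_betw \<Phi> (carrier S) (carrier S') \<and>
     (\<forall>x \<in> carrier S. \<forall>y \<in> carrier S. \<Phi> (lsol S x y) = lsol S' (\<Phi> x) (\<Phi> y))"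

definition isomorphic_solutions :: "'x solution_data \<Rightarrow> 'y solution_data \<Rightarrow> bool" where
  "isomorphic_solutions S S' \<longleftrightarrow>
     is_solution S \<and> is_solution S' \<and> (\<exists>\<Phi>. solution_iso S S' \<Phi>)"

definition solution_congruence :: "'x solution_data \<Rightarrow> ('x \<times> 'x) set \<Rightarrow> bool" where
  "solution_congruence S R \<longleftrightarrow>
     equiv (carrier S) R \<and>
     (\<forall>(x\<^sub>1, x\<^sub>2) \<in> R. \<forall>(y\<^sub>1, y\<^sub>2) \<in> R.
        (lsol S x\<^sub>1 y\<^sub>1, lsol S x\<^sub>2 y\<^sub>2) \<in> R \<and>
        (inv_into (carrier S) (lsol S x\<^sub>1) y\<^sub>1, inv_into (carrier S) (lsol S x\<^sub>2) y\<^sub>2) \<in> R)"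

definition quotient_solution :: "'x solution_data \<Rightarrow> ('x \<times> 'x) set \<Rightarrow> 'x set solution_data" where
  "quotient_solution S R =
     \<lparr>carrier = carrier S // R,
      lsol = (\<lambda>A B. \<Union>a\<in>A. \<Union>b\<in>B. R `` {lsol S a b}),
      rsol = (\<lambda>A B. \<Union>a\<in>A. \<Union>b\<in>B. R `` {rsol S a b})\<rparr>"

section \<open>The solutions on the product of an abelian group and a cyclic group\<close>

text \<open>
  $\mathbb{Z}_n$ is represented by the residues $0, \dots, n - 1$ if $n$ is finite and by all
  integers if $n = \infty$; \<open>residue n\<close> is the canonical projection from the integers.
\<close>

definition residue :: "enat \<Rightarrow> int \<Rightarrow> int" where
  "residue n i = (case n of enat k \<Rightarrow> i mod int k | \<infinity> \<Rightarrow> i)"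

definition Zmod :: "enat \<Rightarrow> int set" where
  "Zmod n = (case n of enat k \<Rightarrow> {0..<int k} | \<infinity> \<Rightarrow> UNIV)"

text \<open>
  The abelian group is an arbitrary \<^locale>\<open>comm_group\<close> and hence written multiplicatively: the
  sum of $a$ and $b$ is \<open>a \<otimes> b\<close>, the zero element is \<open>\<one>\<close>, and the multiple $k \cdot r$ is \<open>r [^] k\<close>.
\<close>

definition prod_solution ::
  "('a, 'b) monoid_scheme \<Rightarrow> enat \<Rightarrow> (int \<Rightarrow> 'a) \<Rightarrow> ('a \<times> int) solution_data" where
  "prod_solution G n c =
     \<lparr>carrier = carrier G \<times> Zmod n,
      lsol = (\<lambda>(a, i) (b, j).
        (b \<otimes>\<^bsub>G\<^esub> c (residue n (i - j - 1)) \<otimes>\<^bsub>G\<^esub> inv\<^bsub>G\<^esub> c (residue n (- j - 1)), residue n (j + 1))),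
      rsol = (\<lambda>(b, j) (a, i).
        (b \<otimes>\<^bsub>G\<^esub> inv\<^bsub>G\<^esub> c (residue n (i - j + 1)) \<otimes>\<^bsub>G\<^esub> c (residue n (- j)), residue n (j - 1)))\<rparr>"

text \<open>The conditions on $(m, H, r)$ under which $\theta(m, H, r)$ is defined.\<close>

definition theta_params ::
  "('a, 'b) monoid_scheme \<Rightarrow> enat \<Rightarrow> (int \<Rightarrow> 'a) \<Rightarrow> enat \<Rightarrow> 'a set \<Rightarrow> 'a \<Rightarrow> bool" where
  "theta_params G n c m H r \<longleftrightarrow>
     1 \<le> m \<and> subgroup H G \<and> r \<in> carrier G \<and>
     (\<forall>k. n = enat k \<longrightarrow> (\<exists>l. m = enat l \<and> l dvd k)) \<and>
     (\<forall>l. m = enat l \<longrightarrow>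
        (\<forall>i \<in> Zmod n. c i \<otimes>\<^bsub>G\<^esub> inv\<^bsub>G\<^esub> c (residue n (i + int l)) \<in> H)) \<and>
     (\<forall>k l. n = enat k \<and> m = enat l \<longrightarrow> r [^]\<^bsub>G\<^esub> (k div l) \<in> H)"

text \<open>
  \<open>(x, y) \<in> rcong\<^bsub>G\<^esub> H\<close> is congruence modulo \<open>H\<close> in \<open>G\<close>. The division below is only used where it
  is exact. For \<open>m = \<infinity>\<close> the relation does not depend on \<open>r\<close>.
\<close>

definition theta ::
  "('a, 'b) monoid_scheme \<Rightarrow> enat \<Rightarrow> enat \<Rightarrow> 'a set \<Rightarrow> 'a \<Rightarrow> (('a \<times> int) \<times> ('a \<times> int)) set" where
  "theta G n m H r =
     {((a, i), (a', i')).
        a \<in> carrier G \<and> i \<in> Zmod n \<and> a' \<in> carrier G \<and> i' \<in> Zmod n \<and>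
        (case m of
           enat l \<Rightarrow> int l dvd i - i' \<and>
             (a' \<otimes>\<^bsub>G\<^esub> inv\<^bsub>G\<^esub> a, r [^]\<^bsub>G\<^esub> ((i - i') div int l)) \<in> rcong\<^bsub>G\<^esub> H
         | \<infinity> \<Rightarrow> i = i' \<and> a' \<otimes>\<^bsub>G\<^esub> inv\<^bsub>G\<^esub> a \<in> H)}"

section \<open>The notions are well defined\<close>

text \<open>
  \<open>prod_solution G n c\<close> is a solution, \<open>theta G n m H r\<close> is a congruence of it, and the quotient
  is a solution. In the proofs, $n$ and $m$ are replaced by integers with \<open>0\<close> for $\infty$, using
  that \<open>i mod 0 = i\<close>, \<open>i div 0 = 0\<close> and that \<open>0\<close> divides \<open>0\<close> only.
\<close>

definition nmod :: "enat \<Rightarrow> int" where "nmod n = (case n of enat k \<Rightarrow> int k | \<infinity> \<Rightarrow> 0)"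

lemma residue_mod: "residue n i = i mod nmod n"
  by (simp add: residue_def nmod_def split: enat.split)

lemma residue_in: "1 \<le> n \<Longrightarrow> residue n i \<in> Zmod n"
  by (auto simp add: residue_def Zmod_def one_enat_def split: enat.split)

lemma residue_id: "i \<in> Zmod n \<Longrightarrow> residue n i = i"
  by (auto simp add: residue_def Zmod_def split: enat.splits)

lemma (in comm_group) cancel_quot:
  assumes [simp]: "p \<in> carrier G" "q \<in> carrier G" "s \<in> carrier G"
  shows "p \<otimes> inv q \<otimes> inv (s \<otimes> inv q) = p \<otimes> inv s"
    "inv (s \<otimes> inv q) \<otimes> (p \<otimes> inv q) = p \<otimes> inv s"
proof -
  have "p \<otimes> inv q \<otimes> inv (s \<otimes> inv q) = p \<otimes> (inv q \<otimes> (q \<otimes> inv s))"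
    by (simp add: m_assoc inv_mult_group)
  also have "\<dots> = p \<otimes> inv s" by (simp add: m_assoc[symmetric])
  finally show "p \<otimes> inv q \<otimes> inv (s \<otimes> inv q) = p \<otimes> inv s" .
  then show "inv (s \<otimes> inv q) \<otimes> (p \<otimes> inv q) = p \<otimes> inv s"
    by (simp add: m_comm)
qed

locale prod_solution_setup = comm_group G for G (structure) +
  fixes n :: enat and c :: "int \<Rightarrow> 'a"
  assumes n1: "1 \<le> n" and cG: "c \<in> Zmod n \<rightarrow> carrier G"
begin

definition C where "C i = c (residue n i)"

lemma C_closed [simp]: "C i \<in> carrier G"
  using cG residue_in[OF n1] by (auto simp: C_def)

lemma res_simps: "residue n (residue n i - k) = residue n (i - k)"
  "residue n (k - residue n i) = residue n (k - i)" "residue n (residue n i + k) = residue n (i + k)"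
  "residue n (residue n i) = residue n i" "residue n (- residue n i) = residue n (- i)"
  by (simp_all add: residue_mod mod_simps)

lemma C_res: "C (residue n i - k) = C (i - k)" "C (k - residue n i) = C (k - i)"
  by (simp_all add: C_def res_simps)

definition D where "D i j = C (i - j - 1) \<otimes> inv C (- j - 1)"
lemma D_closed [simp]: "D i j \<in> carrier G" by (simp add: D_def)

lemma D_res: "D (residue n i) j = D i j" "D i (residue n j) = D i j"
  "D (residue n i + 1) j = D (i + 1) j" "D i (residue n j - 1) = D i (j - 1)"
proof -
  show 1: "D (residue n i) j = D i j" for i j
    using C_res(1)[of i "j+1"] by (simp add: D_def algebra_simps)
  show 2: "D i (residue n j) = D i j" for i j
  proof -
    have "- residue n j - 1 = -1 - residue n j" "i - residue n j - 1 = (i - 1) - residue n j"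
      "- j - 1 = -1 - j" "i - j - 1 = (i - 1) - j" by simp_all
    then show ?thesis unfolding D_def by (simp only: C_res(2))
  qed
  show "D (residue n i + 1) j = D (i + 1) j" by (metis 1 res_simps(3))
  show "D i (residue n j - 1) = D i (j - 1)" by (metis 2 res_simps(1))
qed

lemmas res_res = res_simps

abbreviation "S \<equiv> prod_solution G n c"

lemma S_carrier: "carrier S = carrier G \<times> Zmod n" by (simp add: prod_solution_def)

lemma l: "b \<in> carrier G \<Longrightarrow> lsol S (a,i) (b,j) = (b \<otimes> D i j, residue n (j+1))"
  by (simp add: prod_solution_def D_def C_def[symmetric] m_assoc)

lemma r: "a \<in> carrier G \<Longrightarrow> rsol S (a,i) (b,j) = (a \<otimes> inv D (j+1) (i-1), residue n (i-1))"
  by (simp add: prod_solution_def D_def C_def[symmetric] m_assoc inv_mult algebra_simps)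

lemma eqs:
  "D (i-1) k \<otimes> D (j+1) (k+1) = D j k \<otimes> D i (k+1)"
  "D i j \<otimes> inv D (k+2) j = inv D (k+1) (j-1) \<otimes> D (i-1) (j-1)"
  "inv D (j+1) (i-1) \<otimes> inv D (k+1) (i-2) = inv D (k+2) (i-1) \<otimes> inv D j (i-2)"
proof -
  show "D (i-1) k \<otimes> D (j+1) (k+1) = D j k \<otimes> D i (k+1)"
    by (simp add: D_def algebra_simps m_ac)
  show "D i j \<otimes> inv D (k+2) j = inv D (k+1) (j-1) \<otimes> D (i-1) (j-1)"
    by (simp add: D_def cancel_quot algebra_simps)
  show "inv D (j+1) (i-1) \<otimes> inv D (k+1) (i-2) = inv D (k+2) (i-1) \<otimes> inv D j (i-2)"
    by (simp add: D_def inv_mult algebra_simps m_ac)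
qed

lemma inv_D: "x \<in> carrier G \<Longrightarrow> x \<otimes> D i j \<otimes> inv D i j = x"  "x \<in> carrier G \<Longrightarrow> x \<otimes> inv D i j \<otimes> D i j = x"
  by (simp_all add: m_assoc)

lemma braid:
  assumes t: "t \<in> carrier S \<times> carrier S \<times> carrier S"
  shows "yb_right S (yb_left S (yb_right S t)) = yb_left S (yb_right S (yb_left S t))"
proof -
  obtain x i y j z k where T: "t = ((x,i),(y,j),(z,k))" by (cases t) auto
  with t have [simp]: "x \<in> carrier G" "y \<in> carrier G" "z \<in> carrier G" by (auto simp: S_carrier)
  have a: "z \<otimes> D j k \<otimes> D i (k + 1) = z \<otimes> D (i - 1) k \<otimes> D (j + 1) (k + 1)"
    using eqs(1)[of i k j] by (simp add: m_assoc)
  have b: "y \<otimes> inv D (k + 1) (j - 1) \<otimes> D (i - 1) (j - 1) = y \<otimes> D i j \<otimes> inv D (k + 2) j" for i j k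
    using eqs(2)[of i j k] by (simp add: m_assoc)
  have d: "x \<otimes> inv D (k + 2) (i - 1) \<otimes> inv D j (i - 2) = x \<otimes> inv D (j + 1) (i - 1) \<otimes> inv D (k + 1) (i - 2)"
    using eqs(3)[of j i k] by (simp add: m_assoc)
  note [simp] = D_res res_res
  show ?thesis
    using a b d unfolding T yb_left_def yb_right_def
    by (simp add: l r add.commute[of 2])
qed

lemma invol:
  assumes "p \<in> carrier S \<times> carrier S" shows "yb_map S (yb_map S p) = p"
proof -
  obtain x i y j where T: "p = ((x,i),(y,j))" by (cases p) auto
  with assms have [simp]: "x \<in> carrier G" "y \<in> carrier G"
    and ij: "i \<in> Zmod n" "j \<in> Zmod n" by (auto simp: S_carrier)
  note [simp] = D_res res_res inv_D residue_id[OF ij(1)] residue_id[OF ij(2)]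
  show ?thesis unfolding T yb_map_def by (simp add: l r)
qed

lemma l_in: "x \<in> carrier S \<Longrightarrow> y \<in> carrier S \<Longrightarrow> lsol S x y \<in> carrier S"
  by (cases x; cases y) (auto simp: S_carrier l residue_in[OF n1])
lemma r_in: "x \<in> carrier S \<Longrightarrow> y \<in> carrier S \<Longrightarrow> rsol S x y \<in> carrier S"
  by (cases x; cases y) (auto simp: S_carrier r residue_in[OF n1])

lemma l_inv:
  assumes "x \<in> carrier S"
  defines "g \<equiv> (\<lambda>(b,j). (b \<otimes> inv D (snd x) (j-1), residue n (j - 1)))"
  shows "\<And>y. y \<in> carrier S \<Longrightarrow> g y \<in> carrier S \<and> lsol S x (g y) = y \<and> g (lsol S x y) = y"
  using assms(1) by (auto simp: g_def S_carrier l residue_in[OF n1] D_res res_res residue_id inv_D)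

lemma r_inv':
  assumes "y \<in> carrier S"
  defines "g \<equiv> (\<lambda>(a,i). (a \<otimes> D (snd y + 1) i, residue n (i + 1)))"
  shows "\<And>x. x \<in> carrier S \<Longrightarrow> g x \<in> carrier S \<and> rsol S (g x) y = x \<and> g (rsol S x y) = x"
  using assms(1) by (auto simp: g_def S_carrier r residue_in[OF n1] D_res res_res residue_id inv_D)

lemma l_bij: "x \<in> carrier S \<Longrightarrow> bij_betw (lsol S x) (carrier S) (carrier S)"
  by (rule bij_betw_byWitness[where f' = "(\<lambda>(b,j). (b \<otimes> inv D (snd x) (j-1), residue n (j - 1)))"])
    (use l_inv l_in in blast)+

lemma r_bij: "y \<in> carrier S \<Longrightarrow> bij_betw (\<lambda>x. rsol S x y) (carrier S) (carrier S)"
  by (rule bij_betw_byWitness[where f' = "(\<lambda>(a,i). (a \<otimes> D (snd y + 1) i, residue n (i + 1)))"])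
    (use r_inv' r_in in blast)+

lemma inv_into_l: "x \<in> carrier S \<Longrightarrow> (b, j) \<in> carrier S \<Longrightarrow>
   inv_into (carrier S) (lsol S x) (b, j) = (b \<otimes> inv D (snd x) (j-1), residue n (j - 1))"
  using l_inv[of x "(b,j)"] l_bij[of x]
  by (intro inv_into_f_eq) (auto simp: bij_betw_def)

lemma sol: "is_solution S"
  unfolding is_solution_def
proof (intro conjI ballI braid invol l_bij r_bij)
  have "residue n 0 \<in> Zmod n" by (rule residue_in[OF n1])
  then show "carrier S \<noteq> {}" by (auto simp: S_carrier)
  show "bij_betw (yb_map S) (carrier S \<times> carrier S) (carrier S \<times> carrier S)"
    by (rule bij_betw_byWitness[where f' = "yb_map S"])
      (use invol l_in r_in in \<open>auto simp: yb_map_def split: prod.splits\<close>)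
qed

end

theorem prod_solution_is_solution:
  assumes "1 \<le> n" "comm_group G" "c \<in> Zmod n \<rightarrow> carrier G"
  shows "is_solution (prod_solution G n c)"
proof -
  interpret prod_solution_setup G n c using assms by (simp add: prod_solution_setup_def prod_solution_setup_axioms_def)
  show ?thesis by (rule sol)
qed

text \<open>
  For infinite \<open>S\<close>, injectivity of the maps $\tau_y$ on the quotient is not immediate from the
  definition of a congruence and is required separately.
\<close>

theorem quotient_is_solution:
  assumes S: "is_solution S" and R: "solution_congruence S R"
    and rc: "\<And>x1 x2 y. (x1, x2) \<in> carrier S \<times> carrier S \<Longrightarrow> y \<in> carrier S \<Longrightarrow>
       (rsol S x1 y, rsol S x2 y) \<in> R \<Longrightarrow> (x1, x2) \<in> R"
  shows "is_solution (quotient_solution S R)"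
proof -
  let ?X = "carrier S" and ?Q = "quotient_solution S R"
  have eq: "equiv ?X R" and lR: "\<And>x1 x2 y1 y2. (x1,x2) \<in> R \<Longrightarrow> (y1,y2) \<in> R \<Longrightarrow> (lsol S x1 y1, lsol S x2 y2) \<in> R"
    and iR: "\<And>x1 x2 y1 y2. (x1,x2) \<in> R \<Longrightarrow> (y1,y2) \<in> R \<Longrightarrow>
       (inv_into ?X (lsol S x1) y1, inv_into ?X (lsol S x2) y2) \<in> R"
    using R unfolding solution_congruence_def by blast+
  have lb: "\<And>x. x \<in> ?X \<Longrightarrow> bij_betw (lsol S x) ?X ?X"
    and rb: "\<And>y. y \<in> ?X \<Longrightarrow> bij_betw (\<lambda>x. rsol S x y) ?X ?X"
    and inv: "\<And>x y. x \<in> ?X \<Longrightarrow> y \<in> ?X \<Longrightarrow> yb_map S (yb_map S (x,y)) = (x,y)"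
    and br: "\<And>x y z. x \<in> ?X \<Longrightarrow> y \<in> ?X \<Longrightarrow> z \<in> ?X \<Longrightarrow>
       yb_right S (yb_left S (yb_right S (x,y,z))) = yb_left S (yb_right S (yb_left S (x,y,z)))"
    and ne: "?X \<noteq> {}"
    using S unfolding is_solution_def by auto
  have lin: "\<And>x y. x \<in> ?X \<Longrightarrow> y \<in> ?X \<Longrightarrow> lsol S x y \<in> ?X" using lb bij_betwE by blast
  have rin: "\<And>x y. x \<in> ?X \<Longrightarrow> y \<in> ?X \<Longrightarrow> rsol S x y \<in> ?X" using rb bij_betwE by blast
  have RX: "\<And>x y. (x,y) \<in> R \<Longrightarrow> x \<in> ?X \<and> y \<in> ?X"
    using eq unfolding equiv_def refl_on_def by blast
  have invl: "lsol S (lsol S x y) (rsol S x y) = x" "rsol S (lsol S x y) (rsol S x y) = y" if "x \<in> ?X" "y \<in> ?X" for x y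
    using inv[OF that] by (simp_all add: yb_map_def)
  have rform: "rsol S x y = inv_into ?X (lsol S (lsol S x y)) x" if "x \<in> ?X" "y \<in> ?X" for x y
  proof -
    have "inj_on (lsol S (lsol S x y)) ?X" using lb[OF lin[OF that]] by (simp add: bij_betw_def)
    then show ?thesis using invl[OF that] rin[OF that] by (metis inv_into_f_f)
  qed
  have rR: "(rsol S x1 y1, rsol S x2 y2) \<in> R" if "(x1,x2) \<in> R" "(y1,y2) \<in> R" for x1 x2 y1 y2
    using that RX[OF that(1)] RX[OF that(2)] by (simp add: rform iR lR)
  define q where "q x = R `` {x}" for x
  have qin: "q x \<in> carrier ?Q" if "x \<in> ?X" for x
    using that by (auto simp: quotient_solution_def q_def quotientI)
  have qex: "\<exists>x\<in>?X. A = q x" if "A \<in> carrier ?Q" for A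
    using that by (auto simp: quotient_solution_def q_def quotient_def)
  have qeq: "q x = q y \<longleftrightarrow> (x, y) \<in> R" if "x \<in> ?X" "y \<in> ?X" for x y
    using eq_equiv_class_iff[OF eq that] by (simp add: q_def)
  have l2: "congruent2 R R (\<lambda>a b. R `` {lsol S a b})"
    unfolding congruent2_def using lR equiv_class_eq[OF eq] by blast
  have r2: "congruent2 R R (\<lambda>a b. R `` {rsol S a b})"
    unfolding congruent2_def using rR equiv_class_eq[OF eq] by blast
  have ql: "lsol ?Q (q x) (q y) = q (lsol S x y)" if "x \<in> ?X" "y \<in> ?X" for x y
    using UN_equiv_class2[OF eq eq l2 that] by (simp add: quotient_solution_def q_def)
  have qr: "rsol ?Q (q x) (q y) = q (rsol S x y)" if "x \<in> ?X" "y \<in> ?X" for x y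
    using UN_equiv_class2[OF eq eq r2 that] by (simp add: quotient_solution_def q_def)
  have Linj: "(y1, y2) \<in> R" if "x \<in> ?X" "y1 \<in> ?X" "y2 \<in> ?X" "(lsol S x y1, lsol S x y2) \<in> R" for x y1 y2
  proof -
    have "(x,x) \<in> R" using eq that(1) by (meson equiv_def refl_onD)
    from iR[OF this that(4)] show ?thesis using lb[OF that(1)] that by (simp add: bij_betw_def)
  qed
  have inv': "yb_map ?Q (yb_map ?Q p) = p" if p: "p \<in> carrier ?Q \<times> carrier ?Q" for p
  proof -
    obtain A B where AB: "p = (A, B)" "A \<in> carrier ?Q" "B \<in> carrier ?Q" using p by (cases p) auto
    obtain x y where "p = (q x, q y)" "x \<in> ?X" "y \<in> ?X"
      using qex[OF AB(2)] qex[OF AB(3)] AB(1) by auto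
    then show ?thesis by (simp add: yb_map_def ql qr lin rin invl)
  qed
  show ?thesis unfolding is_solution_def
  proof (intro conjI ballI)
    show "carrier ?Q \<noteq> {}" using ne qin by blast
    show "bij_betw (yb_map ?Q) (carrier ?Q \<times> carrier ?Q) (carrier ?Q \<times> carrier ?Q)"
    proof (rule bij_betw_byWitness[where f' = "yb_map ?Q"])
      show "yb_map ?Q ` (carrier ?Q \<times> carrier ?Q) \<subseteq> carrier ?Q \<times> carrier ?Q"
      proof
        fix u assume "u \<in> yb_map ?Q ` (carrier ?Q \<times> carrier ?Q)"
        then obtain A B where AB: "A \<in> carrier ?Q" "B \<in> carrier ?Q" "u = yb_map ?Q (A, B)" by blast
        then obtain x y where "A = q x" "B = q y" "x \<in> ?X" "y \<in> ?X" using qex by meson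
        then show "u \<in> carrier ?Q \<times> carrier ?Q" using AB by (simp add: yb_map_def ql qr qin lin rin)
      qed
      then show "yb_map ?Q ` (carrier ?Q \<times> carrier ?Q) \<subseteq> carrier ?Q \<times> carrier ?Q" .
    qed (use inv' in auto)
    show "yb_map ?Q (yb_map ?Q p) = p" if "p \<in> carrier ?Q \<times> carrier ?Q" for p by (rule inv'[OF that])
    fix t assume t: "t \<in> carrier ?Q \<times> carrier ?Q \<times> carrier ?Q"
    then obtain A B D where ABD: "t = (A, B, D)" "A \<in> carrier ?Q" "B \<in> carrier ?Q" "D \<in> carrier ?Q"
      by (cases t) auto
    obtain x y z where T: "t = (q x, q y, q z)" and [simp]: "x \<in> ?X" "y \<in> ?X" "z \<in> ?X"
      using qex[OF ABD(2)] qex[OF ABD(3)] qex[OF ABD(4)] ABD(1) by auto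
    show "yb_right ?Q (yb_left ?Q (yb_right ?Q t)) = yb_left ?Q (yb_right ?Q (yb_left ?Q t))"
      using br[of x y z] unfolding T by (simp add: yb_left_def yb_right_def ql qr lin rin)
  next
    fix A assume "A \<in> carrier ?Q"
    then obtain x where A: "A = q x" "x \<in> ?X" using qex by blast
    have "q y \<in> lsol ?Q A ` carrier ?Q" if "y \<in> ?X" for y
    proof -
      have "y \<in> lsol S x ` ?X" using lb[OF A(2)] that unfolding bij_betw_def by simp
      then obtain z where "z \<in> ?X" "y = lsol S x z" by blast
      then have "q y = lsol ?Q A (q z)" "q z \<in> carrier ?Q" using A by (simp_all add: ql qin)
      then show ?thesis by (rule image_eqI)
    qed
    then have "carrier ?Q \<subseteq> lsol ?Q A ` carrier ?Q" using qex by (metis subsetI)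
    moreover have "lsol ?Q A ` carrier ?Q \<subseteq> carrier ?Q"
    proof
      fix u assume "u \<in> lsol ?Q A ` carrier ?Q"
      then obtain B where B: "u = lsol ?Q A B" "B \<in> carrier ?Q" by blast
      then obtain y where "u = lsol ?Q A (q y)" "y \<in> ?X" using qex[OF B(2)] by blast
      then show "u \<in> carrier ?Q" using A by (simp add: ql lin qin)
    qed
    moreover have "inj_on (lsol ?Q A) (carrier ?Q)"
    proof (rule inj_onI)
      fix B D assume "B \<in> carrier ?Q" "D \<in> carrier ?Q" and e: "lsol ?Q A B = lsol ?Q A D"
      then obtain y z where "B = q y" "D = q z" "y \<in> ?X" "z \<in> ?X" using qex by meson
      moreover from this e A have "(lsol S x y, lsol S x z) \<in> R" by (simp add: ql qeq lin)
      ultimately show "B = D" using Linj[OF A(2)] qeq by metis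
    qed
    ultimately show "bij_betw (\<lambda>B. lsol ?Q A B) (carrier ?Q) (carrier ?Q)" unfolding bij_betw_def by (simp add: subset_antisym)
    have "q y \<in> (\<lambda>B. rsol ?Q B A) ` carrier ?Q" if "y \<in> ?X" for y
    proof -
      have "y \<in> (\<lambda>z. rsol S z x) ` ?X" using rb[OF A(2)] that unfolding bij_betw_def by simp
      then obtain z where "z \<in> ?X" "y = rsol S z x" by blast
      then have "q y = rsol ?Q (q z) A" "q z \<in> carrier ?Q" using A by (simp_all add: qr qin)
      then show ?thesis by (rule image_eqI)
    qed
    then have "carrier ?Q \<subseteq> (\<lambda>B. rsol ?Q B A) ` carrier ?Q" using qex by (metis subsetI)
    moreover have "(\<lambda>B. rsol ?Q B A) ` carrier ?Q \<subseteq> carrier ?Q"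
    proof
      fix u assume "u \<in> (\<lambda>B. rsol ?Q B A) ` carrier ?Q"
      then obtain B where B: "u = rsol ?Q B A" "B \<in> carrier ?Q" by blast
      then obtain y where "u = rsol ?Q (q y) A" "y \<in> ?X" using qex[OF B(2)] by blast
      then show "u \<in> carrier ?Q" using A by (simp add: qr rin qin)
    qed
    moreover have "inj_on (\<lambda>B. rsol ?Q B A) (carrier ?Q)"
    proof (rule inj_onI)
      fix B D assume "B \<in> carrier ?Q" "D \<in> carrier ?Q" and e: "rsol ?Q B A = rsol ?Q D A"
      then obtain y z where "B = q y" "D = q z" "y \<in> ?X" "z \<in> ?X" using qex by meson
      moreover from this e A have "(rsol S y x, rsol S z x) \<in> R" by (simp add: qr qeq rin)
      ultimately show "B = D" using rc[of y z x] A(2) qeq by blast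
    qed
    ultimately show "bij_betw (\<lambda>B. rsol ?Q B A) (carrier ?Q) (carrier ?Q)" unfolding bij_betw_def by (simp add: subset_antisym)
  qed
qed

locale theta_setup = prod_solution_setup +
  fixes m H r0
  assumes tp: "theta_params G n c m H r0"
begin

lemma H: "subgroup H G" and rG [simp]: "r0 \<in> carrier G" and m1: "1 \<le> m"
  using tp by (auto simp: theta_params_def)

definition L where "L = nmod m"
definition N where "N = nmod n"

lemma LN: "L dvd N" and rN: "r0 [^] (N div L) \<in> H"
proof -
  have "L dvd N \<and> r0 [^] (N div L) \<in> H"
  proof (cases n)
    case (enat k)
    then obtain l where l: "m = enat l" "l dvd k" "r0 [^] (k div l) \<in> H" using tp by (auto simp: theta_params_def)
    have "L = int l" "N = int k" unfolding L_def N_def by (simp_all add: nmod_def enat l(1))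
    then show ?thesis using l(2,3) by (simp add: int_pow_int flip: zdiv_int)
  next
    case infinity
    have "N = 0" unfolding N_def by (simp add: nmod_def infinity)
    then show ?thesis using subgroup.one_closed[OF H] by simp
  qed
  then show "L dvd N" "r0 [^] (N div L) \<in> H" by auto
qed

definition K (infix "~~" 50) where "x ~~ y \<longleftrightarrow> (x, y) \<in> rcong H"

lemma K_iff: "x ~~ y \<longleftrightarrow> x \<in> carrier G \<and> y \<in> carrier G \<and> inv x \<otimes> y \<in> H"
  by (simp add: K_def r_congruent_def)
lemma K_equiv: "equiv (carrier G) (rcong H)"
  using subgroup.equiv_rcong[OF H] is_group by blast
lemma K_refl: "x \<in> carrier G \<Longrightarrow> x ~~ x" using K_equiv by (simp add: K_def equiv_def refl_on_def)
lemma K_sym: "x ~~ y \<Longrightarrow> y ~~ x" using K_equiv by (simp add: K_def equiv_def sym_def)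
lemma K_trans: "x ~~ y \<Longrightarrow> y ~~ z \<Longrightarrow> x ~~ z" using K_equiv unfolding K_def equiv_def trans_def by blast
lemma K_in: "x ~~ y \<Longrightarrow> x \<in> carrier G" "x ~~ y \<Longrightarrow> y \<in> carrier G" by (auto simp: K_iff)
lemma K_mult: assumes "x ~~ y" "u ~~ v" shows "x \<otimes> u ~~ y \<otimes> v"
proof -
  have [simp]: "x \<in> carrier G" "y \<in> carrier G" "u \<in> carrier G" "v \<in> carrier G"
    and h: "inv x \<otimes> y \<in> H" "inv u \<otimes> v \<in> H" using assms by (auto simp: K_iff)
  have "inv (x \<otimes> u) \<otimes> (y \<otimes> v) = (inv x \<otimes> y) \<otimes> (inv u \<otimes> v)" by (simp add: inv_mult m_ac)
  then show ?thesis using h subgroup.m_closed[OF H] by (simp add: K_iff)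
qed
lemma K_inv: assumes "x ~~ y" shows "inv x ~~ inv y"
proof -
  have [simp]: "x \<in> carrier G" "y \<in> carrier G"
    and h: "inv x \<otimes> y \<in> H" using assms by (auto simp: K_iff)
  have "inv (inv x) \<otimes> inv y = inv (inv x \<otimes> y)" by (simp add: inv_mult)
  then show ?thesis using h subgroup.m_inv_closed[OF H] by (simp add: K_iff)
qed
lemma K_H: "h \<in> H \<Longrightarrow> \<one> ~~ h" using subgroup.subset[OF H] by (auto simp: K_iff)
lemma K_cancel: assumes "x \<otimes> u ~~ y \<otimes> v" "u ~~ v" "x \<in> carrier G" "y \<in> carrier G" shows "x ~~ y"
  using K_mult[OF assms(1) K_inv[OF assms(2)]] assms(3,4) K_in[OF assms(2)] by (simp add: m_assoc)

definition E where "E = (\<lambda>(a, i) (a', i'). L dvd i - i' \<and> a \<otimes> r0 [^] ((i - i') div L) ~~ a')"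

lemma theta_E: "(x, y) \<in> theta G n m H r0 \<longleftrightarrow> x \<in> carrier S \<and> y \<in> carrier S \<and> E x y"
proof -
  obtain a i a' i' where xy: "x = (a,i)" "y = (a',i')" by (cases x; cases y) auto
  have main: "(a' \<otimes> inv a, p) \<in> rcong H \<longleftrightarrow> a \<otimes> p ~~ a'"
    if [simp]: "a \<in> carrier G" "a' \<in> carrier G" "p \<in> carrier G" for p
  proof -
    have "inv (a' \<otimes> inv a) \<otimes> p = inv a' \<otimes> (a \<otimes> p)" by (simp add: inv_mult m_ac)
    then have "(a' \<otimes> inv a, p) \<in> rcong H \<longleftrightarrow> a' ~~ a \<otimes> p" by (simp add: r_congruent_def K_iff)
    then show ?thesis using K_sym by blast
  qed
  show ?thesis
  proof (cases m)
    case (enat l)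
    have "L = int l" unfolding L_def by (simp add: nmod_def enat)
    moreover have "(x, y) \<in> theta G n m H r0 \<longleftrightarrow> x \<in> carrier S \<and> y \<in> carrier S \<and>
       int l dvd i - i' \<and> (a' \<otimes> inv a, r0 [^] ((i - i') div int l)) \<in> rcong H"
      using enat by (auto simp: theta_def xy S_carrier)
    ultimately show ?thesis using main[of "r0 [^] ((i - i') div int l)"]
      by (auto simp: xy S_carrier E_def)
  next
    case infinity
    have "a' \<otimes> inv a \<in> H \<longleftrightarrow> a ~~ a'" if [simp]: "a \<in> carrier G" "a' \<in> carrier G"
      by (simp add: K_iff m_comm)
    moreover have "L = 0" unfolding L_def by (simp add: nmod_def infinity)
    moreover have "(x, y) \<in> theta G n m H r0 \<longleftrightarrow> x \<in> carrier S \<and> y \<in> carrier S \<and>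
       i = i' \<and> a' \<otimes> inv a \<in> H"
      using infinity by (auto simp: theta_def xy S_carrier)
    ultimately show ?thesis by (auto simp: xy S_carrier E_def)
  qed
qed

lemma E_refl: "a \<in> carrier G \<Longrightarrow> E (a,i) (a,i)" by (simp add: E_def K_refl)
lemma E_sym: assumes "a \<in> carrier G" "E (a,i) (b,j)" shows "E (b,j) (a,i)"
proof -
  from assms obtain q where q: "i - j = L * q" by (auto simp: E_def)
  have q': "j - i = L * (- q)" using q by simp
  have k: "a \<otimes> r0 [^] ((i - j) div L) ~~ b" using assms by (simp add: E_def)
  have neg: "(j - i) div L = - ((i - j) div L)" unfolding q q' by (cases "L = 0") (simp_all del: mult_minus_right)
  have "b \<otimes> r0 [^] ((j - i) div L) ~~ a \<otimes> r0 [^] ((i - j) div L) \<otimes> r0 [^] ((j - i) div L)"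
    using K_mult[OF K_sym[OF k] K_refl] by simp
  also have "a \<otimes> r0 [^] ((i - j) div L) \<otimes> r0 [^] ((j - i) div L) = a"
    using assms(1) by (simp add: neg m_assoc int_pow_neg)
  finally show ?thesis by (simp add: E_def q')
qed
lemma E_trans: assumes "a \<in> carrier G" "E (a,i) (b,j)" "E (b,j) (e,k)" shows "E (a,i) (e,k)"
proof -
  have d: "L dvd i - j" "L dvd j - k" and k: "a \<otimes> r0 [^] ((i - j) div L) ~~ b" "b \<otimes> r0 [^] ((j - k) div L) ~~ e"
    using assms by (auto simp: E_def)
  have s: "i - k = (i - j) + (j - k)" by simp
  have e: "(i - k) div L = (i - j) div L + (j - k) div L"
    using d unfolding s by (simp only: div_plus_div_distrib_dvd_left)
  have "a \<otimes> r0 [^] ((i - j) div L) \<otimes> r0 [^] ((j - k) div L) ~~ e"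
    using K_trans[OF K_mult[OF k(1) K_refl] k(2)] by simp
  then have "a \<otimes> r0 [^] ((i - k) div L) ~~ e" using assms(1) by (simp add: e int_pow_mult m_assoc)
  moreover have "L dvd i - k" using d unfolding s by (rule dvd_add)
  ultimately show ?thesis by (simp add: E_def)
qed

lemma E_residue: assumes "a \<in> carrier G" shows "E (a, i) (a, residue n i)"
proof -
  have eq: "i - residue n i = N * (i div N)" by (simp add: residue_mod N_def minus_mod_eq_mult_div)
  have "(N * (i div N)) div L = (N div L) * (i div N)" using LN by (simp add: dvd_div_mult)
  then have "r0 [^] ((i - residue n i) div L) = (r0 [^] (N div L)) [^] (i div N)"
    by (simp add: eq int_pow_pow)
  moreover have "(r0 [^] (N div L)) [^] (i div N) \<in> H"
    using rN subgroup_int_pow_closed[OF H] by blast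
  ultimately have "\<one> ~~ r0 [^] ((i - residue n i) div L)" using K_H by simp
  from K_mult[OF K_refl[OF assms] K_sym[OF this]] have "a \<otimes> r0 [^] ((i - residue n i) div L) ~~ a" using assms by simp
  moreover have "L dvd i - residue n i" using LN by (simp add: eq)
  ultimately show ?thesis by (simp add: E_def)
qed

lemma E_res: assumes "a \<in> carrier G" "b \<in> carrier G" "E (a,i) (b,j)" shows "E (a, residue n i) (b, residue n j)"
  using E_trans E_sym E_residue assms by meson

lemma E_shift: assumes "E (a,i) (b,j)" "u ~~ v" "a \<in> carrier G" "b \<in> carrier G" shows "E (a \<otimes> u, i + k) (b \<otimes> v, j + k)"
proof -
  have "a \<otimes> r0 [^] ((i - j) div L) \<otimes> u ~~ b \<otimes> v" using assms K_mult by (auto simp: E_def)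
  also have "a \<otimes> r0 [^] ((i - j) div L) \<otimes> u = a \<otimes> u \<otimes> r0 [^] ((i - j) div L)"
    using assms K_in[OF assms(2)] by (simp add: m_ac)
  finally (back_subst) show ?thesis using assms by (simp add: E_def)
qed

lemma C_L: "C i ~~ C (i + L)"
proof (cases m)
  case (enat l)
  have z: "residue n i \<in> Zmod n" by (rule residue_in[OF n1])
  have "c (residue n i) \<otimes> inv c (residue n (residue n i + int l)) \<in> H"
    using tp z enat by (auto simp: theta_params_def)
  moreover have "L = int l" unfolding L_def by (simp add: nmod_def enat)
  ultimately have "C i \<otimes> inv C (i + L) \<in> H" by (simp add: C_def res_simps)
  then have "C (i + L) ~~ C i" by (simp add: K_iff m_comm)
  then show ?thesis by (rule K_sym)
next
  case infinity
  have "L = 0" unfolding L_def by (simp add: nmod_def infinity)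
  then show ?thesis by (simp add: K_refl)
qed

lemma C_q: "C i ~~ C (i + L * int q)"
proof (induction q)
  case (Suc q)
  then show ?case using K_trans[OF Suc C_L] by (simp add: algebra_simps)
qed (simp add: K_refl)

lemma C_cong: assumes "L dvd i - j" shows "C i ~~ C j"
proof -
  from assms obtain q where "i - j = L * q" by blast
  then have i: "i = j + L * q" by simp
  show ?thesis
  proof (cases "q \<ge> 0")
    case True
    then show ?thesis using C_q[of j "nat q"] K_sym i by simp
  next
    case False
    then show ?thesis using C_q[of i "nat (-q)"] i by simp
  qed
qed

lemma D_cong: assumes "L dvd i - i'" "L dvd j - j'" shows "D i j ~~ D i' j'"
proof -
  have "L dvd (i - i') - (j - j')" using assms by (rule dvd_diff)
  then have "L dvd (i - j - 1) - (i' - j' - 1)" by (simp add: algebra_simps)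
  moreover have "L dvd (- j - 1) - (- j' - 1)" using assms(2) by (simp add: dvd_diff_commute)
  ultimately show ?thesis unfolding D_def by (intro K_mult K_inv C_cong)
qed

lemma cong: "solution_congruence S (theta G n m H r0)"
  unfolding solution_congruence_def
proof
  show "equiv (carrier S) (theta G n m H r0)"
    by (rule equivI)
      (auto simp: refl_on_def sym_def trans_def theta_E S_carrier intro: E_refl E_sym E_trans)
  show "\<forall>(x1, x2) \<in> theta G n m H r0. \<forall>(y1, y2) \<in> theta G n m H r0.
        (lsol S x1 y1, lsol S x2 y2) \<in> theta G n m H r0 \<and>
        (inv_into (carrier S) (lsol S x1) y1, inv_into (carrier S) (lsol S x2) y2) \<in> theta G n m H r0"
  proof (clarify, goal_cases)
    case (1 a i a' i' b j b' j')
    then have x: "(a,i) \<in> carrier S" "(a',i') \<in> carrier S" "E (a,i) (a',i')"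
      and y: "(b,j) \<in> carrier S" "(b',j') \<in> carrier S" "E (b,j) (b',j')" by (auto simp: theta_E)
    then have [simp]: "b \<in> carrier G" "b' \<in> carrier G" by (auto simp: S_carrier)
    have d: "L dvd i - i'" "L dvd j - j'" using x y by (auto simp: E_def)
    have "E (b \<otimes> D i j, j + 1) (b' \<otimes> D i' j', j' + 1)"
      using y d by (intro E_shift D_cong) auto
    from E_res[OF _ _ this] have "E (lsol S (a,i) (b,j)) (lsol S (a',i') (b',j'))" by (simp add: l)
    moreover
    have "E (b \<otimes> inv D i (j-1), j + -1) (b' \<otimes> inv D i' (j'-1), j' + -1)"
      using y d by (intro E_shift K_inv D_cong) auto
    from E_res[OF _ _ this] have "E (inv_into (carrier S) (lsol S (a,i)) (b,j)) (inv_into (carrier S) (lsol S (a',i')) (b',j'))"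
      using x y by (simp add: inv_into_l)
    moreover have "inv_into (carrier S) (lsol S x) y \<in> carrier S" if "x \<in> carrier S" "y \<in> carrier S" for x y
      using l_bij[OF that(1)] that(2) by (metis bij_betw_def inv_into_into)
    ultimately show ?case using x y l_in by (simp add: theta_E)
  qed
qed

lemma quot: "is_solution (quotient_solution S (theta G n m H r0))"
proof (rule quotient_is_solution[OF sol cong])
  fix x1 x2 y
  assume X: "(x1,x2) \<in> carrier S \<times> carrier S" and Y: "y \<in> carrier S"
    and t: "(rsol S x1 y, rsol S x2 y) \<in> theta G n m H r0"
  obtain a i b j e k where eq: "x1 = (a,i)" "x2 = (b,j)" "y = (e,k)" by (cases x1; cases x2; cases y) auto
  from X Y have [simp]: "a \<in> carrier G" "b \<in> carrier G" and z: "i \<in> Zmod n" "j \<in> Zmod n" by (auto simp: eq S_carrier)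
  let ?u = "D (k+1) (i-1)" and ?v = "D (k+1) (j-1)"
  have "E (a \<otimes> inv ?u, residue n (i-1)) (b \<otimes> inv ?v, residue n (j-1))"
    using t by (simp add: theta_E eq r)
  then have E1: "E (a \<otimes> inv ?u, i-1) (b \<otimes> inv ?v, j-1)"
    using E_trans E_sym E_residue by (meson \<open>a \<in> carrier G\<close> \<open>b \<in> carrier G\<close> D_closed inv_closed m_closed)
  then have "L dvd i - j" by (simp add: E_def)
  then have "?u ~~ ?v" by (intro D_cong) auto
  from E_shift[OF E1 this, of 1] have "E (a,i) (b,j)" by (simp add: inv_D)
  then show "(x1, x2) \<in> theta G n m H r0" using X by (simp add: theta_E eq)
qed

end

theorem theta_quotient_is_solution:
  assumes "1 \<le> n" "comm_group G" "c \<in> Zmod n \<rightarrow> carrier G" "theta_params G n c m H r"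
  shows "solution_congruence (prod_solution G n c) (theta G n m H r)"
    "is_solution (quotient_solution (prod_solution G n c) (theta G n m H r))"
proof -
  interpret theta_setup G n c m H r using assms by (simp add: prod_solution_setup_def prod_solution_setup_axioms_def theta_setup_def theta_setup_axioms_def)
  show "solution_congruence (prod_solution G n c) (theta G n m H r)"
    "is_solution (quotient_solution (prod_solution G n c) (theta G n m H r))" by (rule cong, rule quot)
qed

end

theory Submission
  imports Defs
begin

text \<open>
  The automorphism group of the solution acts transitively and preserves every congruence
  $\theta(m, H, r)$, so an isomorphism between the two quotients may be assumed to fix the class of
  $(0, 0)$. The point $(0, 0)$ alone generates the solution under all $\sigma_x^{\pm 1}$, hence such
  an isomorphism is induced by the identity and $\theta_1 = \theta_2$ as relations. Finally, $m$,
  $H$ and $r$ modulo $H$ can be read off from the relation.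
\<close>

section \<open>Integer codes of extended naturals, and quotients\<close>

lemma nmod_inject: "1 \<le> m \<Longrightarrow> 1 \<le> k \<Longrightarrow> nmod m = nmod k \<longleftrightarrow> m = k"
  \<comment> \<open>The lower bounds exclude \<open>enat 0\<close>, which shares the code 0 with
    infinity.\<close>
  by (auto simp: nmod_def one_enat_def split: enat.splits)

lemma nmod_nonneg: "0 \<le> nmod m"
  by (simp add: nmod_def split: enat.split)

lemma residue_0 [simp]: "residue n 0 = 0"
  by (simp add: residue_mod)

lemma quotient_lsol:
  assumes "solution_congruence S R" "x \<in> carrier S" "y \<in> carrier S"
  shows "lsol (quotient_solution S R) (R `` {x}) (R `` {y}) = R `` {lsol S x y}"
proof -
  have eq: "equiv (carrier S) R"
    and lR: "\<And>x1 x2 y1 y2. (x1, x2) \<in> R \<Longrightarrow> (y1, y2) \<in> R \<Longrightarrow> (lsol S x1 y1, lsol S x2 y2) \<in> R"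
    using assms(1) unfolding solution_congruence_def by blast+
  have "congruent2 R R (\<lambda>a b. R `` {lsol S a b})"
    unfolding congruent2_def using lR equiv_class_eq[OF eq] by blast
  from UN_equiv_class2[OF eq eq this assms(2,3)] show ?thesis
    by (simp add: quotient_solution_def)
qed

lemma solution_iso_id: "solution_iso S S (\<lambda>x. x)"
  by (simp add: solution_iso_def bij_betw_def)

section \<open>Generation of the solution by one point\<close>

lemma (in prod_solution_setup) one_0_in: "(\<one>, 0) \<in> carrier S"
  using residue_in[OF n1, of 0] by (simp add: S_carrier)

text \<open>The set \<open>W\<close> will be the equalizer of two homomorphisms. Stating
  \<open>W_lsol\<close> as an equivalence covers both the left translations and their
  inverses.\<close>

lemma (in prod_solution_setup) carrier_generated:
  assumes c0: "c 0 = \<one>" and gen: "generate G (c ` Zmod n) = carrier G"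
    and W1: "(\<one>, 0) \<in> W"
    and W_lsol: "\<And>x y. x \<in> carrier S \<Longrightarrow> y \<in> carrier S \<Longrightarrow> x \<in> W \<Longrightarrow> lsol S x y \<in> W \<longleftrightarrow> y \<in> W"
  shows "carrier S \<subseteq> W"
proof -
  have Z [simp]: "residue n j \<in> Zmod n" "0 \<in> Zmod n" for j
    using residue_in[OF n1, of j] residue_in[OF n1, of 0] by simp_all
  have step: "(b \<otimes> D i j, residue n (j + 1)) \<in> W \<longleftrightarrow> (b, residue n j) \<in> W"
    if "b \<in> carrier G" "(\<one>, residue n i) \<in> W" for b i j
    using W_lsol[of "(\<one>, residue n i)" "(b, residue n j)"] that
    by (simp add: l S_carrier D_res res_simps)
  \<comment> \<open>\<open>D 0 j\<close> is the unit, so acting by the base point only advances the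
    index; membership in \<open>W\<close> therefore depends on the group component alone.\<close>
  have succ: "(b, residue n (j + 1)) \<in> W \<longleftrightarrow> (b, residue n j) \<in> W" if "b \<in> carrier G" for b j
    using step[of b 0 j] W1 that by (simp add: D_def)
  have level: "(b, residue n j) \<in> W \<longleftrightarrow> (b, 0) \<in> W" if b: "b \<in> carrier G" for b j
  proof (induction j rule: int_induct[where k = 0])
    case (step2 i)
    then show ?case using succ[OF b, of "i - 1"] by simp
  qed (use succ[OF b] in simp_all)
  have C0: "C 0 = \<one>" by (simp add: C_def c0)
  \<comment> \<open>Acting by index \<open>i\<close> on index -1 lands in index 0 and multiplies by
    \<open>D i (-1)\<close>, which is \<open>C i\<close> because \<open>C 0\<close> is the
    unit.\<close>
  have mult: "(b \<otimes> C i, 0) \<in> W \<longleftrightarrow> (b, 0) \<in> W" if b: "b \<in> carrier G" for b i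
    using step[of b i "-1"] level[of \<one> i] level[of b "-1"] W1 b C0 by (simp add: D_def)
  have "\<forall>b\<in>carrier G. (b, 0) \<in> W \<longrightarrow> (b \<otimes> h, 0) \<in> W" if "h \<in> generate G (c ` Zmod n)" for h
    using that
  proof induction
    case (incl h)
    then obtain i where "h = c i" "i \<in> Zmod n" by auto
    then have "h = C i" by (simp add: C_def residue_id)
    then show ?case using mult by simp
  next
    case (inv h)
    then obtain i where "h = c i" "i \<in> Zmod n" by auto
    then have h: "h = C i" by (simp add: C_def residue_id)
    show ?case
    proof (intro ballI impI)
      fix b assume "b \<in> carrier G" "(b, 0) \<in> W"
      \<comment> \<open>Multiplication by \<open>C i\<close> read backwards, from \<open>b\<close>
        to \<open>b \<otimes> inv C i\<close>.\<close>
      then show "(b \<otimes> inv h, 0) \<in> W" using mult[of "b \<otimes> inv C i" i] by (simp add: h m_assoc)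
    qed
  next
    case (eng h1 h2)
    then have [simp]: "h1 \<in> carrier G" "h2 \<in> carrier G" by (simp_all add: gen)
    show ?case
    proof (intro ballI impI)
      fix b assume [simp]: "b \<in> carrier G" and "(b, 0) \<in> W"
      then have "(b \<otimes> h1 \<otimes> h2, 0) \<in> W" using eng by simp
      then show "(b \<otimes> (h1 \<otimes> h2), 0) \<in> W" by (simp add: m_assoc)
    qed
  qed simp
  then have W0: "(b, 0) \<in> W" if "b \<in> carrier G" for b
    using W1 that gen by (metis l_one one_closed)
  show ?thesis
    using W0 level residue_id by (auto simp: S_carrier) metis
qed

section \<open>Shift automorphisms compatible with the congruence\<close>

context theta_setup
begin

text \<open>Lets computations use integer indices such as \<open>i + k\<close> or \<open>L\<close>,
  although \<open>theta\<close> relates only canonical residues.\<close>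

lemma E_res_iff:
  assumes "a \<in> carrier G" "b \<in> carrier G"
  shows "E (a, residue n i) (b, residue n j) \<longleftrightarrow> E (a, i) (b, j)"
  using assms E_res E_trans E_sym E_residue by meson

text \<open>
  \<open>shift_cocycle k f\<close> makes \<open>shift_map k f\<close> an automorphism of \<open>S\<close> compatible with \<open>theta\<close>; the
  last clause is what compatibility with \<open>lsol\<close> amounts to.
\<close>

definition shift_cocycle :: "int \<Rightarrow> (int \<Rightarrow> 'a) \<Rightarrow> bool" where
  "shift_cocycle k f \<longleftrightarrow>
     (\<forall>j. f j \<in> carrier G) \<and> (\<forall>j. f (residue n j) = f j) \<and>
     (\<forall>i j. L dvd i - j \<longrightarrow> f i ~~ f j) \<and>
     (\<forall>j. f (j + 1) \<otimes> C (- j - k - 1) = f j \<otimes> C (- j - 1))"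

definition shift_map :: "int \<Rightarrow> (int \<Rightarrow> 'a) \<Rightarrow> 'a \<times> int \<Rightarrow> 'a \<times> int" where
  "shift_map k f = (\<lambda>(b, j). (b \<otimes> f j, residue n (j + k)))"

lemma C_res_neg: "C (- residue n j - k) = C (- j - k)"
  using C_res(2)[of "- k" j] by (simp add: minus_diff_commute)

lemma shift_cocycle_const: "u \<in> carrier G \<Longrightarrow> shift_cocycle 0 (\<lambda>_. u)"
  by (simp add: shift_cocycle_def K_refl)

text \<open>The new map is \<open>shift_map k f\<close> followed by the automorphism that sends (b,
  j) to (b - c_{-j-1}, j + 1), written additively.\<close>

lemma shift_cocycle_succ:
  assumes "shift_cocycle k f"
  shows "shift_cocycle (k + 1) (\<lambda>j. f j \<otimes> inv C (- j - (k + 1)))"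
proof -
  have [simp]: "f j \<in> carrier G" "f (residue n j) = f j"
    and K: "L dvd i - j \<Longrightarrow> f i ~~ f j"
    and f: "f (j + 1) \<otimes> C (- j - k - 1) = f j \<otimes> C (- j - 1)" for i j
    using assms by (auto simp: shift_cocycle_def)
  have "f i \<otimes> inv C (- i - (k + 1)) ~~ f j \<otimes> inv C (- j - (k + 1))" if "L dvd i - j" for i j
    using that by (intro K_mult K_inv K C_cong) (simp_all add: dvd_diff_commute)
  moreover have "f (j + 1) = f j \<otimes> inv C (- j - (k + 1)) \<otimes> C (- j - 1)" for j
  proof -
    have e: "C (- j - (k + 1)) = C (- j - k - 1)" by (rule arg_cong[where f = C]) simp
    have "f (j + 1) = f (j + 1) \<otimes> C (- j - k - 1) \<otimes> inv C (- j - k - 1)"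
      by (simp add: m_assoc)
    then show ?thesis by (simp add: f e m_ac)
  qed
  moreover have "f (j + 1) \<otimes> inv C (- (j + 1) - (k + 1)) \<otimes> C (- j - (k + 1) - 1) = f (j + 1)" for j
    by (simp add: m_assoc algebra_simps)
  ultimately show ?thesis by (simp add: shift_cocycle_def C_res_neg)
qed

text \<open>Here the second factor is the inverse automorphism, sending (b, j) to (b + c_{-j}, j -
  1).\<close>

lemma shift_cocycle_pred:
  assumes "shift_cocycle k f"
  shows "shift_cocycle (k - 1) (\<lambda>j. f j \<otimes> C (- j - k))"
proof -
  have [simp]: "f j \<in> carrier G" "f (residue n j) = f j"
    and K: "L dvd i - j \<Longrightarrow> f i ~~ f j"
    and f: "f (j + 1) \<otimes> C (- j - k - 1) = f j \<otimes> C (- j - 1)" for i j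
    using assms by (auto simp: shift_cocycle_def)
  have "f i \<otimes> C (- i - k) ~~ f j \<otimes> C (- j - k)" if "L dvd i - j" for i j
    using that by (intro K_mult K C_cong) (simp_all add: dvd_diff_commute)
  moreover have "f (j + 1) \<otimes> C (- (j + 1) - k) \<otimes> C (- j - (k - 1) - 1)
      = f j \<otimes> C (- j - k) \<otimes> C (- j - 1)" for j
  proof -
    have "- (j + 1) - k = - j - k - 1" "- j - (k - 1) - 1 = - j - k" by simp_all
    then have "f (j + 1) \<otimes> C (- (j + 1) - k) \<otimes> C (- j - (k - 1) - 1)
      = f j \<otimes> C (- j - 1) \<otimes> C (- j - k)" by (simp only: f)
    then show ?thesis by (simp add: m_ac)
  qed
  ultimately show ?thesis by (simp add: shift_cocycle_def C_res_neg)
qed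

text \<open>Transitivity of the automorphisms: such a shift carries the base point to the point with
  group component \<open>u\<close> and index \<open>k\<close>. The value \<open>u\<close> varies in
  the induction because each step changes \<open>f 0\<close>.\<close>

lemma shift_cocycle_exists: "u \<in> carrier G \<Longrightarrow> \<exists>f. shift_cocycle k f \<and> f 0 = u"
proof (induction k arbitrary: u rule: int_induct[where k = 0])
  case base
  then show ?case using shift_cocycle_const by blast
next
  case (step1 k)
  \<comment> \<open>This starting value cancels the factor \<open>inv C (- (k + 1))\<close> that the
    successor step contributes at 0.\<close>
  then obtain f where "shift_cocycle k f" "f 0 = u \<otimes> C (- (k + 1))" by (metis C_closed m_closed)
  with shift_cocycle_succ[OF this(1)] step1.prems show ?case
    by (intro exI[of _ "\<lambda>j. f j \<otimes> inv C (- j - (k + 1))"]) (simp add: m_assoc)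
next
  case (step2 k)
  then obtain f where "shift_cocycle k f" "f 0 = u \<otimes> inv C (- k)"
    by (metis C_closed inv_closed m_closed)
  with shift_cocycle_pred[OF this(1)] step2.prems show ?case
    by (intro exI[of _ "\<lambda>j. f j \<otimes> C (- j - k)"]) (simp add: m_assoc)
qed

context
  fixes k f
  assumes f: "shift_cocycle k f"
begin

lemma shift_map_in: "x \<in> carrier S \<Longrightarrow> shift_map k f x \<in> carrier S"
  using f residue_in[OF n1] by (auto simp: shift_cocycle_def shift_map_def S_carrier)

lemma shift_map_lsol:
  assumes "x \<in> carrier S" "y \<in> carrier S"
  shows "shift_map k f (lsol S x y) = lsol S (shift_map k f x) (shift_map k f y)"
proof -
  obtain a i b j where xy: "x = (a, i)" "y = (b, j)" by (cases x; cases y)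
  have [simp]: "b \<in> carrier G" "f j \<in> carrier G" "f (residue n j) = f j" for j
    using assms f by (auto simp: xy S_carrier shift_cocycle_def)
  have fj: "f (j + 1) \<otimes> C (- j - k - 1) = f j \<otimes> C (- j - 1)"
    using f by (simp add: shift_cocycle_def)
  \<comment> \<open>Shifting both indices preserves \<open>i - j\<close>, so \<open>D\<close>
    changes only in its second factor, and the cocycle equation absorbs that change.\<close>
  have "D i j \<otimes> f (j + 1) = f j \<otimes> D (i + k) (j + k)"
  proof -
    have e: "f (j + 1) = f j \<otimes> C (- j - 1) \<otimes> inv C (- j - k - 1)"
      unfolding fj[symmetric] by (simp add: m_assoc)
    have "D i j \<otimes> f (j + 1) = (inv C (- j - 1) \<otimes> C (- j - 1)) \<otimes>
        (f j \<otimes> (C (i - j - 1) \<otimes> inv C (- j - k - 1)))"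
      unfolding e D_def by (simp only: m_ac C_closed inv_closed m_closed \<open>\<And>j. f j \<in> carrier G\<close>)
    moreover have "D (i + k) (j + k) = C (i - j - 1) \<otimes> inv C (- j - k - 1)"
      by (simp add: D_def algebra_simps)
    ultimately show ?thesis by simp
  qed
  then have "b \<otimes> D i j \<otimes> f (j + 1) = b \<otimes> f j \<otimes> D (i + k) (j + k)"
    by (simp add: m_assoc)
  moreover have "residue n (residue n (j + 1) + k) = residue n (residue n (j + k) + 1)"
    by (simp add: residue_mod mod_simps algebra_simps)
  ultimately show ?thesis by (simp add: xy shift_map_def l D_res)
qed

text \<open>On related points the values of \<open>f\<close> agree modulo \<open>H\<close>, so the
  translation can be added or cancelled on both sides. The equivalence makes the induced map on the
  quotient injective.\<close>

lemma shift_map_theta: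
  assumes "x \<in> carrier S" "y \<in> carrier S"
  shows "(shift_map k f x, shift_map k f y) \<in> theta G n m H r0 \<longleftrightarrow> (x, y) \<in> theta G n m H r0"
proof -
  obtain a i b j where xy: "x = (a, i)" "y = (b, j)" by (cases x; cases y)
  have [simp]: "a \<in> carrier G" "b \<in> carrier G" "f j \<in> carrier G" for j
    using assms f by (auto simp: xy S_carrier shift_cocycle_def)
  have K: "f i ~~ f j" if "L dvd i - j" using f that by (simp add: shift_cocycle_def)
  have "E (a \<otimes> f i, i + k) (b \<otimes> f j, j + k) \<longleftrightarrow> E (a, i) (b, j)"
  proof
    assume 1: "E (a \<otimes> f i, i + k) (b \<otimes> f j, j + k)"
    then have "L dvd i - j" by (simp add: E_def)
    from E_shift[OF 1 K_inv[OF K[OF this]], of "- k"] show "E (a, i) (b, j)"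
      by (simp add: m_assoc)
  next
    assume 1: "E (a, i) (b, j)"
    then have "L dvd i - j" by (simp add: E_def)
    from E_shift[OF 1 K[OF this], of k] show "E (a \<otimes> f i, i + k) (b \<otimes> f j, j + k)"
      by simp
  qed
  then show ?thesis
    using assms shift_map_in by (simp add: theta_E) (simp add: xy shift_map_def E_res_iff)
qed

end

section \<open>Recovering the parameters from the relation\<close>

lemma theta_H: "h \<in> H \<longleftrightarrow> h \<in> carrier G \<and> ((\<one>, 0), (h, 0)) \<in> theta G n m H r0"
proof -
  have "0 \<in> Zmod n" using one_0_in by (simp add: S_carrier)
  then show ?thesis using subgroup.mem_carrier[OF H] by (auto simp: theta_E E_def S_carrier K_iff)
qed

text \<open>The indices met by the class of the base point are exactly the multiples of
  \<open>L\<close>. Divisibility treats infinite \<open>m\<close>, where \<open>L\<close> is 0,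
  uniformly.\<close>

lemma theta_L: "L dvd k \<longleftrightarrow> (\<exists>a\<in>carrier G. ((\<one>, 0), (a, residue n k)) \<in> theta G n m H r0)"
proof -
  have "((\<one>, 0), (a, residue n k)) \<in> theta G n m H r0 \<longleftrightarrow> L dvd k \<and> r0 [^] (- k div L) ~~ a"
    if "a \<in> carrier G" for a
  proof -
    have "((\<one>, 0), (a, residue n k)) \<in> theta G n m H r0 \<longleftrightarrow> E (\<one>, residue n 0) (a, residue n k)"
      using that one_0_in residue_in[OF n1] by (simp add: theta_E S_carrier)
    also have "\<dots> \<longleftrightarrow> E (\<one>, 0) (a, k)" using that by (intro E_res_iff) simp_all
    finally show ?thesis by (simp add: E_def)
  qed
  then show ?thesis using K_refl rG int_pow_closed by blast
qed

text \<open>A difference of indices equal to \<open>L\<close> makes the exponent of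
  \<open>r0\<close> equal to 1. If \<open>m\<close> equals a finite \<open>n\<close>, the residue of
  \<open>L\<close> is 0, and this is consistent because then \<open>r0\<close> lies in
  \<open>H\<close>.\<close>

lemma theta_r:
  assumes "L \<noteq> 0" "a \<in> carrier G"
  shows "((\<one>, residue n L), (a, 0)) \<in> theta G n m H r0 \<longleftrightarrow> r0 ~~ a"
proof -
  have "((\<one>, residue n L), (a, 0)) \<in> theta G n m H r0 \<longleftrightarrow> E (\<one>, residue n L) (a, residue n 0)"
    using assms one_0_in residue_in[OF n1] by (simp add: theta_E S_carrier)
  also have "\<dots> \<longleftrightarrow> E (\<one>, L) (a, 0)" using assms by (intro E_res_iff) simp_all
  finally show ?thesis using assms(1) by (simp add: E_def)
qed

end

lemma (in prod_solution_setup) theta_eq_iff: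
  assumes "theta_params G n c m\<^sub>1 H\<^sub>1 r\<^sub>1" "theta_params G n c m\<^sub>2 H\<^sub>2 r\<^sub>2"
  shows "theta G n m\<^sub>1 H\<^sub>1 r\<^sub>1 = theta G n m\<^sub>2 H\<^sub>2 r\<^sub>2 \<longleftrightarrow>
    m\<^sub>1 = m\<^sub>2 \<and> H\<^sub>1 = H\<^sub>2 \<and> (m\<^sub>1 \<noteq> \<infinity> \<longrightarrow> (r\<^sub>1, r\<^sub>2) \<in> rcong H\<^sub>2)"
proof -
  interpret t1: theta_setup G n c m\<^sub>1 H\<^sub>1 r\<^sub>1 by unfold_locales (rule assms)
  interpret t2: theta_setup G n c m\<^sub>2 H\<^sub>2 r\<^sub>2 by unfold_locales (rule assms)
  show ?thesis
  proof
    assume eq: "theta G n m\<^sub>1 H\<^sub>1 r\<^sub>1 = theta G n m\<^sub>2 H\<^sub>2 r\<^sub>2"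
    have dvd: "t1.L dvd k \<longleftrightarrow> t2.L dvd k" for k by (simp add: t1.theta_L t2.theta_L eq)
    \<comment> \<open>Each of the two nonnegative integers divides the other.\<close>
    have L: "t1.L = t2.L"
      using dvd[of t1.L] dvd[of t2.L]
      by (intro zdvd_antisym_nonneg) (simp_all add: t1.L_def t2.L_def nmod_nonneg)
    then have m: "m\<^sub>1 = m\<^sub>2" using nmod_inject t1.m1 t2.m1 by (simp add: t1.L_def t2.L_def)
    have H: "H\<^sub>1 = H\<^sub>2" using t1.theta_H t2.theta_H eq by blast
    have "(r\<^sub>1, r\<^sub>2) \<in> rcong H\<^sub>2" if "m\<^sub>1 \<noteq> \<infinity>"
    proof -
      have "t2.L \<noteq> 0" using that m t2.m1
        by (auto simp: t2.L_def nmod_def one_enat_def split: enat.splits)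
      \<comment> \<open>The witness is \<open>r\<^sub>2\<close> itself: by reflexivity it satisfies
        the criterion for the second relation, hence also for the first.\<close>
      then have "r\<^sub>1 \<in> carrier G \<and> t1.K r\<^sub>1 r\<^sub>2"
        using t1.theta_r[of r\<^sub>2] t2.theta_r[of r\<^sub>2] t2.K_refl[of r\<^sub>2] t2.rG L eq by simp
      then show ?thesis by (simp add: t1.K_def t2.K_def H)
    qed
    with m H show "m\<^sub>1 = m\<^sub>2 \<and> H\<^sub>1 = H\<^sub>2 \<and> (m\<^sub>1 \<noteq> \<infinity> \<longrightarrow> (r\<^sub>1, r\<^sub>2) \<in> rcong H\<^sub>2)" by blast
  next
    assume *: "m\<^sub>1 = m\<^sub>2 \<and> H\<^sub>1 = H\<^sub>2 \<and> (m\<^sub>1 \<noteq> \<infinity> \<longrightarrow> (r\<^sub>1, r\<^sub>2) \<in> rcong H\<^sub>2)"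
    show "theta G n m\<^sub>1 H\<^sub>1 r\<^sub>1 = theta G n m\<^sub>2 H\<^sub>2 r\<^sub>2"
    proof (cases "m\<^sub>1 = \<infinity>")
      case True
      then show ?thesis using * by (auto simp: theta_def)
    next
      case False
      \<comment> \<open>The parameter \<open>r\<close> enters \<open>E\<close> only through its
        integer powers.\<close>
      have pow: "t2.K (r\<^sub>1 [^] k) (r\<^sub>2 [^] k)" for k :: int
      proof -
        have "inv r\<^sub>1 \<otimes> r\<^sub>2 \<in> H\<^sub>2" using * False by (simp add: r_congruent_def)
        then have "(inv r\<^sub>1 \<otimes> r\<^sub>2) [^] k \<in> H\<^sub>2" using subgroup_int_pow_closed[OF t2.H] by blast
        then show ?thesis by (simp add: t2.K_iff int_pow_distrib int_pow_inv)
      qed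
      have L: "t1.L = t2.L" and K: "t1.K = t2.K"
        using * by (simp_all add: t1.L_def t2.L_def t1.K_def t2.K_def fun_eq_iff)
      have "t1.E (a, i) (b, j) \<longleftrightarrow> t2.E (a, i) (b, j)" if "a \<in> carrier G" for a i b j
        unfolding t1.E_def t2.E_def L K
        using that t2.K_mult[OF t2.K_refl[of a] pow] t2.K_sym t2.K_trans by blast
      then have "(x, y) \<in> theta G n m\<^sub>1 H\<^sub>1 r\<^sub>1 \<longleftrightarrow> (x, y) \<in> theta G n m\<^sub>2 H\<^sub>2 r\<^sub>2" for x y
        unfolding t1.theta_E t2.theta_E by (cases x; cases y) (auto simp: S_carrier)
      then show ?thesis by auto
    qed
  qed
qed

section \<open>Comparing an isomorphism of quotients with an automorphism\<close>

theorem theorem5p19: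
  fixes G :: "('a, 'b) monoid_scheme"
    and n m\<^sub>1 m\<^sub>2 :: enat
    and c :: "int \<Rightarrow> 'a"
    and H\<^sub>1 H\<^sub>2 :: "'a set"
    and r\<^sub>1 r\<^sub>2 :: 'a
  assumes "1 \<le> n"
    and "comm_group G"
    and "c \<in> Zmod n \<rightarrow> carrier G"
    and "c 0 = \<one>\<^bsub>G\<^esub>"
    and "generate G (c ` Zmod n) = carrier G"
    and "theta_params G n c m\<^sub>1 H\<^sub>1 r\<^sub>1"
    and "theta_params G n c m\<^sub>2 H\<^sub>2 r\<^sub>2"
  shows "isomorphic_solutions
           (quotient_solution (prod_solution G n c) (theta G n m\<^sub>1 H\<^sub>1 r\<^sub>1))
           (quotient_solution (prod_solution G n c) (theta G n m\<^sub>2 H\<^sub>2 r\<^sub>2))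
         \<longleftrightarrow> m\<^sub>1 = m\<^sub>2 \<and> H\<^sub>1 = H\<^sub>2 \<and> (m\<^sub>1 \<noteq> \<infinity> \<longrightarrow> (r\<^sub>1, r\<^sub>2) \<in> rcong\<^bsub>G\<^esub> H\<^sub>2)"
proof -
  interpret prod_solution_setup G n c
    using assms by (simp add: prod_solution_setup_def prod_solution_setup_axioms_def)
  interpret t1: theta_setup G n c m\<^sub>1 H\<^sub>1 r\<^sub>1 by unfold_locales (rule assms)
  interpret t2: theta_setup G n c m\<^sub>2 H\<^sub>2 r\<^sub>2 by unfold_locales (rule assms)
  define R\<^sub>1 where "R\<^sub>1 = theta G n m\<^sub>1 H\<^sub>1 r\<^sub>1"
  define R\<^sub>2 where "R\<^sub>2 = theta G n m\<^sub>2 H\<^sub>2 r\<^sub>2"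
  let ?Q\<^sub>1 = "quotient_solution S R\<^sub>1" and ?Q\<^sub>2 = "quotient_solution S R\<^sub>2"
  have cong: "solution_congruence S R\<^sub>1" "solution_congruence S R\<^sub>2"
    and sols: "is_solution ?Q\<^sub>1" "is_solution ?Q\<^sub>2"
    unfolding R\<^sub>1_def R\<^sub>2_def by (rule t1.cong t2.cong t1.quot t2.quot)+
  then have eqv: "equiv (carrier S) R\<^sub>1" "equiv (carrier S) R\<^sub>2"
    by (simp_all add: solution_congruence_def)
  have class_in: "R\<^sub>1 `` {x} \<in> carrier ?Q\<^sub>1" "R\<^sub>2 `` {x} \<in> carrier ?Q\<^sub>2" if "x \<in> carrier S" for x
    using that by (simp_all add: quotient_solution_def quotientI)
  have "R\<^sub>1 = R\<^sub>2" if iso: "solution_iso ?Q\<^sub>1 ?Q\<^sub>2 \<Phi>" for \<Phi>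
  proof -
    \<comment> \<open>An isomorphism is lifted to a homomorphism from \<open>S\<close> whose kernel
      relation is \<open>R\<^sub>1\<close>.\<close>
    define g where "g x = \<Phi> (R\<^sub>1 `` {x})" for x
    have \<Phi>: "bij_betw \<Phi> (carrier ?Q\<^sub>1) (carrier ?Q\<^sub>2)"
      and \<Phi>_lsol: "\<And>A B. A \<in> carrier ?Q\<^sub>1 \<Longrightarrow> B \<in> carrier ?Q\<^sub>1 \<Longrightarrow>
        \<Phi> (lsol ?Q\<^sub>1 A B) = lsol ?Q\<^sub>2 (\<Phi> A) (\<Phi> B)"
      using iso by (auto simp: solution_iso_def)
    have g_in: "g x \<in> carrier ?Q\<^sub>2" if "x \<in> carrier S" for x
      using that bij_betwE[OF \<Phi>] class_in(1) by (simp add: g_def)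
    have g_lsol: "g (lsol S x y) = lsol ?Q\<^sub>2 (g x) (g y)" if "x \<in> carrier S" "y \<in> carrier S" for x y
      using \<Phi>_lsol[OF class_in(1) class_in(1)] that by (simp add: g_def quotient_lsol[OF cong(1)])
    have g_eq: "g x = g y \<longleftrightarrow> (x, y) \<in> R\<^sub>1" if "x \<in> carrier S" "y \<in> carrier S" for x y
      using that class_in(1) inj_on_eq_iff[OF bij_betw_imp_inj_on[OF \<Phi>]]
        eq_equiv_class_iff[OF eqv(1)] by (simp add: g_def)
    obtain u k where uk: "g (\<one>\<^bsub>G\<^esub>, 0) = R\<^sub>2 `` {(u, k)}" and u: "u \<in> carrier G" and k: "k \<in> Zmod n"
      using g_in[OF one_0_in] by (auto simp: quotient_solution_def S_carrier elim!: quotientE)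
    obtain f where f: "t2.shift_cocycle k f" and f0: "f 0 = u"
      using t2.shift_cocycle_exists[OF u] by blast
    \<comment> \<open>A second homomorphism into the same quotient, with kernel relation
      \<open>R\<^sub>2\<close>; the choice of \<open>f\<close> makes it agree with \<open>g\<close>
      at the base point.\<close>
    define h where "h x = R\<^sub>2 `` {t2.shift_map k f x}" for x
    have h_in: "h x \<in> carrier ?Q\<^sub>2" if "x \<in> carrier S" for x
      using that t2.shift_map_in[OF f] class_in(2) by (simp add: h_def)
    have h_lsol: "h (lsol S x y) = lsol ?Q\<^sub>2 (h x) (h y)" if "x \<in> carrier S" "y \<in> carrier S" for x y
      using that t2.shift_map_in[OF f]
      by (simp add: h_def t2.shift_map_lsol[OF f] quotient_lsol[OF cong(2)])
    have h_eq: "h x = h y \<longleftrightarrow> (x, y) \<in> R\<^sub>2" if "x \<in> carrier S" "y \<in> carrier S" for x y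
      using that t2.shift_map_in[OF f] t2.shift_map_theta[OF f]
        eq_equiv_class_iff[OF eqv(2)] by (simp add: h_def R\<^sub>2_def)
    have "carrier S \<subseteq> {x. g x = h x}"
    proof (rule carrier_generated[OF assms(4,5)])
      show "(\<one>\<^bsub>G\<^esub>, 0) \<in> {x. g x = h x}"
        using u k by (simp add: uk h_def t2.shift_map_def f0 residue_id)
    next
      fix x y assume xy: "x \<in> carrier S" "y \<in> carrier S" "x \<in> {x. g x = h x}"
      \<comment> \<open>Cancelling a left translation in the quotient gives the direction from the
        image back to \<open>y\<close>.\<close>
      have "inj_on (lsol ?Q\<^sub>2 (h x)) (carrier ?Q\<^sub>2)"
        using sols(2) h_in[OF xy(1)] by (simp add: is_solution_def bij_betw_def)
      then show "lsol S x y \<in> {x. g x = h x} \<longleftrightarrow> y \<in> {x. g x = h x}"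
        using xy by (simp add: g_lsol h_lsol g_in h_in inj_on_eq_iff)
    qed
    then have gh: "g x = h x" if "x \<in> carrier S" for x using that by blast
    have "(x, y) \<in> R\<^sub>1 \<longleftrightarrow> (x, y) \<in> R\<^sub>2" if "x \<in> carrier S" "y \<in> carrier S" for x y
      using g_eq[OF that] h_eq[OF that] gh[OF that(1)] gh[OF that(2)] by simp
    moreover have "R\<^sub>1 \<subseteq> carrier S \<times> carrier S" "R\<^sub>2 \<subseteq> carrier S \<times> carrier S"
      using eqv by (auto simp: equiv_def)
    ultimately show ?thesis by auto
  qed
  then have "isomorphic_solutions ?Q\<^sub>1 ?Q\<^sub>2 \<longleftrightarrow> R\<^sub>1 = R\<^sub>2"
    using sols solution_iso_id unfolding isomorphic_solutions_def by metis
  then show ?thesis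
    using theta_eq_iff[OF assms(6,7)] by (simp add: R\<^sub>1_def R\<^sub>2_def)
qed

end
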